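(* Let $n,T$ be positive integers and $\epsilon\ge0$. Define $$\Psi_\epsilon:=\begin{bmatrix}\epsilon T I_n&0\\ 0&-I_T\end{bmatrix},\qquad \Phi_\epsilon:=\begin{bmatrix}\epsilon T&0\\ 0&-I_{nT}\end{bmatrix}.$$ Then $$\mathcal{W}_{\mathrm{ib}}(\epsilon)\subseteq\mathcal{W}_{\mathrm F}(\Phi_\epsilon)\subseteq\mathcal{W}_{\mathrm{qmi}}(\Psi_\epsilon).$$ Moreover, $\mathcal{W}_{\mathrm F}(\Phi_\epsilon)=\mathcal{W}_{\mathrm{qmi}}(\Psi_\epsilon)$ if and only if at least one of the following holds: $\epsilon=0$, $n=1$ or $T=1$.
   Context: All matrices are real; $\ge0$ for a symmetric matrix means positive semidefinite; $\operatorname{vec}(W)$ stacks the columns of $W$ into one column vector; $W_i$ denotes the $i$-th column of $W$; $\|\cdot\|_2$ is the Euclidean norm of a vector. The noise sets are $$\mathcal{W}_{\mathrm{ib}}(\epsilon):=\{W\in\mathbb{R}^{n\times T}\mid\|W_i\|_2^2\le\epsilon\text{ for }i=1,\dots,T\},$$ $$\mathcal{W}_{\mathrm{qmi}}(\Psi):=\Big\{W\in\mathbb{R}^{n\times T}\ \Big|\ \begin{bmatrix}I\\ W^\top\end{bmatrix}^\top\Psi\begin{bmatrix}I\\ W^\top\end{bmatrix}\ge0\Big\},$$ $$\mathcal{W}_{\mathrm F}(\Phi):=\Big\{W\in\mathbb{R}^{n\times T}\ \Big|\ \begin{bmatrix}1\\ \operatorname{vec}(W)\end{bmatrix}^\top\Phi\begin{bmatrix}1\\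 \operatorname{vec}(W)\end{bmatrix}\ge0\Big\},$$ for symmetric $\Psi$ of size $n+T$ and symmetric $\Phi$ of size $1+nT$. *)

theory Defs
  imports "HOL-Analysis.Analysis"
begin

text \<open>
  A real matrix with \<open>n\<close> rows and \<open>T\<close> columns is an element of \<^typ>\<open>real^'T^'n\<close>, where
  \<open>n = CARD('n)\<close> and \<open>T = CARD('T)\<close> (automatically positive). Block indices are sum types,
  so a square matrix of size \<open>n + T\<close> has type \<^typ>\<open>real^('n + 'T)^('n + 'T)\<close>.
\<close>

text \<open>
  Vertical concatenation. With a scalar entry type it concatenates column vectors; with a row
  type \<open>real^'k\<close> as entry type it puts one matrix on top of another.
\<close>

definition stack :: "'a^'p::finite \<Rightarrow> 'a^'q::finite \<Rightarrow> 'a^('p + 'q)" where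
  "stack A B = (\<chi> i. case i of Inl a \<Rightarrow> A $ a | Inr b \<Rightarrow> B $ b)"

definition block_mat ::
    "real^'r::finite^'p::finite \<Rightarrow> real^'s::finite^'p \<Rightarrow>
     real^'r^'q::finite \<Rightarrow> real^'s^'q \<Rightarrow> real^('r + 's)^('p + 'q)" where
  "block_mat A B C D = stack (\<chi> i. stack (A $ i) (B $ i)) (\<chi> i. stack (C $ i) (D $ i))"

definition pos_semidef :: "real^'m^'m::finite \<Rightarrow> bool" where
  "pos_semidef A \<longleftrightarrow> transpose A = A \<and> (\<forall>x. 0 \<le> x \<bullet> (A *v x))"

text \<open>
  Column stacking: the index \<open>(j, i)\<close> is position \<open>i\<close> inside the \<open>j\<close>-th column, so the blocks
  of the stacked vector are indexed by the columns of \<open>W\<close>.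
\<close>

definition vec_cols :: "real^'T::finite^'n::finite \<Rightarrow> real^('T \<times> 'n)" where
  "vec_cols W = (\<chi> p. column (fst p) W $ snd p)"

definition W_ib :: "real \<Rightarrow> (real^'T::finite^'n::finite) set" where
  "W_ib \<epsilon> = {W. \<forall>i. (norm (column i W))\<^sup>2 \<le> \<epsilon>}"

definition W_qmi ::
    "real^('n + 'T)^('n + 'T) \<Rightarrow> (real^'T::finite^'n::finite) set" where
  "W_qmi \<Psi> = {W. pos_semidef
     (transpose (stack (mat 1) (transpose W)) ** \<Psi> ** stack (mat 1) (transpose W))}"

text \<open>The quadratic form is scalar-valued here, so it is written with the inner product.\<close>

definition W_F ::
    "real^(1 + 'T \<times> 'n)^(1 + 'T \<times> 'n) \<Rightarrow> (real^'T::finite^'n::finite) set" where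
  "W_F \<Phi> = {W. 0 \<le> stack (1 :: real^1) (vec_cols W) \<bullet> (\<Phi> *v stack (1 :: real^1) (vec_cols W))}"

definition Psi_eps :: "real \<Rightarrow> real^('n::finite + 'T::finite)^('n + 'T)" where
  "Psi_eps \<epsilon> = block_mat ((\<epsilon> * real CARD('T)) *\<^sub>R mat 1) 0 0 (- mat 1)"

definition Phi_eps :: "real \<Rightarrow> real^(1 + 'T::finite \<times> 'n::finite)^(1 + 'T \<times> 'n)" where
  "Phi_eps \<epsilon> = block_mat ((\<epsilon> * real CARD('T)) *\<^sub>R mat 1) 0 0 (- mat 1)"

end

theory Submission
  imports Defs
begin

text \<open>
  The set \<open>W_F (Phi_eps \<epsilon>)\<close> is the ball of squared radius \<open>\<epsilon> T\<close> in the Frobenius norm, and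
  \<open>W_qmi (Psi_eps \<epsilon>)\<close> is the ball of the same radius in the spectral norm. The Frobenius norm
  dominates the spectral norm, and the two agree on matrices with a single row or column. With
  two rows and two columns available, the matrix with two entries \<open>sqrt (\<epsilon> T)\<close> in different rows
  and columns has spectral norm \<open>sqrt (\<epsilon> T)\<close> but a larger Frobenius norm.
\<close>

lemma sum_UNIV_Plus:
  fixes f :: "'p::finite + 'q::finite \<Rightarrow> 'b::comm_monoid_add"
  shows "sum f UNIV = (\<Sum>a\<in>UNIV. f (Inl a)) + (\<Sum>b\<in>UNIV. f (Inr b))"
  unfolding UNIV_Plus_UNIV[symmetric] by (subst sum.Plus) (simp_all add: comp_def)

lemma stack_nth [simp]:
  "stack A B $ Inl a = A $ a" "stack A B $ Inr b = B $ b"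
  by (simp_all add: stack_def)

lemma inner_stack: "stack u v \<bullet> stack u' v' = u \<bullet> u' + v \<bullet> v'"
  by (simp add: inner_vec_def sum_UNIV_Plus)

lemma stack_mult_vec: "stack A B *v x = stack (A *v x) (B *v x)"
  by (simp add: vec_eq_iff matrix_vector_mult_def stack_def split: sum.split)

lemma block_mat_mult_stack:
  "block_mat A B C D *v stack u v = stack (A *v u + B *v v) (C *v u + D *v v)"
  unfolding vec_eq_iff
proof
  fix i
  show "(block_mat A B C D *v stack u v) $ i = stack (A *v u + B *v v) (C *v u + D *v v) $ i"
    by (cases i) (simp_all add: block_mat_def matrix_vector_mult_def sum_UNIV_Plus)
qed

lemma transpose_block_mat:
  "transpose (block_mat A B C D) =
     block_mat (transpose A) (transpose C) (transpose B) (transpose D)"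
  unfolding vec_eq_iff
proof (intro allI)
  fix i j
  show "transpose (block_mat A B C D) $ i $ j =
      block_mat (transpose A) (transpose C) (transpose B) (transpose D) $ i $ j"
    by (cases i; cases j) (simp_all add: block_mat_def transpose_def)
qed

text \<open>\<open>pos_semidef\<close> also demands symmetry; the product defining
  \<open>W_qmi\<close> inherits it from \<open>Psi_eps\<close>.\<close>

lemma transpose_Psi_eps:
  "transpose (Psi_eps \<epsilon> :: real^('a::finite + 'b::finite)^('a + 'b)) = Psi_eps \<epsilon>"
proof -
  have "transpose ((\<epsilon> * real CARD('b)) *\<^sub>R mat 1 :: real^'a^'a) = (\<epsilon> * real CARD('b)) *\<^sub>R mat 1"
    and "transpose (- mat 1 :: real^'b^'b) = - mat 1"
    and "transpose (0 :: real^'a^'b) = 0" and "transpose (0 :: real^'b^'a) = 0"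
    by (auto simp: transpose_def mat_def vec_eq_iff)
  then show ?thesis
    by (simp add: Psi_eps_def transpose_block_mat)
qed

lemma norm_square_vec: "(norm x)\<^sup>2 = (\<Sum>i\<in>UNIV. (norm (x $ i))\<^sup>2)"
  by (simp add: norm_vec_def L2_set_def sum_nonneg)

lemma norm_square_eq_sum_columns:
  fixes W :: "real^'T::finite^'n::finite"
  shows "(norm W)\<^sup>2 = (\<Sum>j\<in>UNIV. (norm (column j W))\<^sup>2)"
  unfolding power2_norm_eq_inner inner_vec_def column_def
  by (simp add: sum.swap[of _ "UNIV :: 'n set"])

lemma norm_square_vec_cols: "(norm (vec_cols W))\<^sup>2 = (norm W)\<^sup>2"
proof -
  have "(norm (vec_cols W))\<^sup>2 = (\<Sum>p\<in>UNIV \<times> UNIV. (column (fst p) W $ snd p)\<^sup>2)"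
    by (simp add: norm_square_vec vec_cols_def)
  also have "\<dots> = (\<Sum>j\<in>UNIV. (norm (column j W))\<^sup>2)"
    by (simp add: norm_square_vec sum.cartesian_product case_prod_beta)
  finally show ?thesis
    by (simp add: norm_square_eq_sum_columns)
qed

text \<open>The blocks being diagonal, the quadratic form is \<epsilon> T minus the squared norm of
  \<open>vec_cols W\<close>, and stacking the columns preserves the sum of squared entries.\<close>

lemma W_F_Phi_eps_iff:
  fixes W :: "real^'T::finite^'n::finite"
  shows "W \<in> W_F (Phi_eps \<epsilon>) \<longleftrightarrow> (norm W)\<^sup>2 \<le> \<epsilon> * real CARD('T)"
proof -
  have one: "(1 :: real^1) \<bullet> 1 = 1"
    by (simp add: inner_vec_def)
  \<comment> \<open>Negation is read as subtraction from 0, so that distributivity over differences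
    applies.\<close>
  have neg: "(- mat 1) *v v = - v" for v :: "real^('T \<times> 'n)"
    using matrix_vector_mult_diff_rdistrib[of 0 "mat 1" v] by simp
  show ?thesis
    by (simp add: W_F_def Phi_eps_def block_mat_mult_stack inner_stack neg one
        scaleR_matrix_vector_assoc[symmetric] norm_square_vec_cols[symmetric] power2_norm_eq_inner)
qed

text \<open>The stacked matrix sends x to x on top of \<open>x v* W\<close>, which is the transpose
  of W applied to x. The form of \<open>Psi_eps\<close> at this vector is the difference of the two
  sides of the inequality.\<close>

lemma W_qmi_Psi_eps_iff:
  fixes W :: "real^'T::finite^'n::finite"
  shows "W \<in> W_qmi (Psi_eps \<epsilon>) \<longleftrightarrow>
    (\<forall>x. (norm (x v* W))\<^sup>2 \<le> \<epsilon> * real CARD('T) * (norm x)\<^sup>2)"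
proof -
  let ?S = "stack (mat 1) (transpose W)" and ?P = "Psi_eps \<epsilon> :: real^('n + 'T)^('n + 'T)"
  have neg: "(- mat 1) *v v = - v" for v :: "real^'T"
    using matrix_vector_mult_diff_rdistrib[of 0 "mat 1" v] by simp
  have "transpose (transpose ?S ** ?P ** ?S) = transpose ?S ** ?P ** ?S"
    by (simp add: matrix_transpose_mul transpose_Psi_eps matrix_mul_assoc)
  moreover have "x \<bullet> ((transpose ?S ** ?P ** ?S) *v x) =
      \<epsilon> * real CARD('T) * (norm x)\<^sup>2 - (norm (x v* W))\<^sup>2" for x
  proof -
    \<comment> \<open>The outer transpose moves to the other argument of the inner product.\<close>
    have "x \<bullet> ((transpose ?S ** ?P ** ?S) *v x) = (?S *v x) \<bullet> (?P *v (?S *v x))"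
      by (simp only: matrix_vector_mul_assoc[symmetric] dot_lmul_matrix[symmetric]
          vector_transpose_matrix)
    also have "\<dots> = \<epsilon> * real CARD('T) * (norm x)\<^sup>2 - (norm (x v* W))\<^sup>2"
      by (simp add: Psi_eps_def stack_mult_vec block_mat_mult_stack inner_stack neg
          scaleR_matrix_vector_assoc[symmetric] power2_norm_eq_inner)
    finally show ?thesis .
  qed
  ultimately show ?thesis
    by (simp add: W_qmi_def pos_semidef_def)
qed

lemma vector_mult_matrix_nth: "(x v* W) $ j = column j W \<bullet> (x :: real^'n::finite)"
  by (simp add: vector_matrix_mult_def column_def inner_vec_def mult.commute)

lemma norm_square_vector_mult_matrix:
  fixes x :: "real^'n::finite"
  shows "(norm (x v* W))\<^sup>2 = (\<Sum>j\<in>UNIV. (column j W \<bullet> x)\<^sup>2)"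
  by (simp add: norm_square_vec vector_mult_matrix_nth)

text \<open>Cauchy-Schwarz for each column against x, summed over the columns.\<close>

lemma norm_square_vector_mult_matrix_le:
  fixes x :: "real^'n::finite"
  shows "(norm (x v* W))\<^sup>2 \<le> (norm W)\<^sup>2 * (norm x)\<^sup>2"
  unfolding norm_square_vector_mult_matrix norm_square_eq_sum_columns sum_distrib_right
  by (intro sum_mono) (simp add: Cauchy_Schwarz_ineq power2_norm_eq_inner)

lemma W_ib_subset_W_F:
  "(W_ib \<epsilon> :: (real^'T::finite^'n::finite) set) \<subseteq> W_F (Phi_eps \<epsilon>)"
proof
  fix W :: "real^'T^'n"
  assume "W \<in> W_ib \<epsilon>"
  then have "(\<Sum>j\<in>UNIV. (norm (column j W))\<^sup>2) \<le> (\<Sum>j\<in>(UNIV :: 'T set). \<epsilon>)"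
    by (intro sum_mono) (simp add: W_ib_def)
  then show "W \<in> W_F (Phi_eps \<epsilon>)"
    by (simp add: W_F_Phi_eps_iff norm_square_eq_sum_columns mult.commute)
qed

lemma W_F_subset_W_qmi:
  "(W_F (Phi_eps \<epsilon>) :: (real^'T::finite^'n::finite) set) \<subseteq> W_qmi (Psi_eps \<epsilon>)"
  unfolding subset_iff W_F_Phi_eps_iff W_qmi_Psi_eps_iff
  by (meson mult_right_mono norm_square_vector_mult_matrix_le order_trans zero_le_power2)

text \<open>Testing the spectral bound on standard basis vectors bounds each row, and there are n
  rows. This settles equality both for n = 1 and for \<epsilon> = 0, where the bound is 0.\<close>

lemma norm_square_le_of_W_qmi:
  fixes W :: "real^'T::finite^'n::finite"
  assumes "W \<in> W_qmi (Psi_eps \<epsilon>)"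
  shows "(norm W)\<^sup>2 \<le> real CARD('n) * (\<epsilon> * real CARD('T))"
proof -
  have "(norm (W $ i))\<^sup>2 \<le> \<epsilon> * real CARD('T)" for i
  proof -
    have "axis i 1 v* W = W $ i"
      by (simp add: vec_eq_iff vector_mult_matrix_nth inner_axis column_def)
    then show ?thesis
      using assms by (auto simp: W_qmi_Psi_eps_iff dest: spec[of _ "axis i 1"])
  qed
  then have "(\<Sum>i\<in>UNIV. (norm (W $ i))\<^sup>2) \<le> (\<Sum>i\<in>(UNIV :: 'n set). \<epsilon> * real CARD('T))"
    by (intro sum_mono)
  then show ?thesis
    by (simp add: norm_square_vec[of W])
qed

lemma norm_square_le_of_W_qmi_single_column:
  fixes W :: "real^'T::finite^'n::finite"
  assumes W: "W \<in> W_qmi (Psi_eps \<epsilon>)" and T: "CARD('T) = 1" and "0 \<le> \<epsilon>"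
  shows "(norm W)\<^sup>2 \<le> \<epsilon> * real CARD('T)"
proof -
  obtain k where k: "(UNIV :: 'T set) = {k}"
    using T by (auto simp: card_1_singleton_iff)
  define w where "w = column k W"
  \<comment> \<open>The test vector is the only column w itself, the case of equality in
    Cauchy-Schwarz; T = 1 removes the factor T.\<close>
  have "(w \<bullet> w)\<^sup>2 \<le> \<epsilon> * (norm w)\<^sup>2"
    using W[unfolded W_qmi_Psi_eps_iff norm_square_vector_mult_matrix k] T
    by (auto simp: w_def)
  then have "(norm w)\<^sup>2 * (norm w)\<^sup>2 \<le> \<epsilon> * (norm w)\<^sup>2"
    by (simp only: power2_norm_eq_inner power2_eq_square[of "w \<bullet> w"])
  \<comment> \<open>Cancelling the squared norm of w requires it to be positive; for w = 0 the bound
    is just 0 \<le> \<epsilon>.\<close>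
  then have "(norm w)\<^sup>2 \<le> \<epsilon>" if "w \<noteq> 0"
    by (rule mult_right_le_imp_le) (simp add: that)
  with \<open>0 \<le> \<epsilon>\<close> have "(norm w)\<^sup>2 \<le> \<epsilon>"
    by (cases "w = 0") simp_all
  then show ?thesis
    using T by (simp add: norm_square_eq_sum_columns k w_def)
qed

lemma ex_W_qmi_not_W_F:
  assumes "0 < \<epsilon>" and "CARD('n) \<noteq> 1" and "CARD('T) \<noteq> 1"
  shows "\<exists>W :: real^'T::finite^'n::finite. W \<in> W_qmi (Psi_eps \<epsilon>) \<and> W \<notin> W_F (Phi_eps \<epsilon>)"
proof -
  obtain a b :: 'n where ab: "a \<noteq> b"
    using assms(2) by (metis UNIV_not_empty is_singletonI' is_singleton_altdef)
  obtain c d :: 'T where cd: "c \<noteq> d"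
    using assms(3) by (metis UNIV_not_empty is_singletonI' is_singleton_altdef)
  define r where "r = \<epsilon> * real CARD('T)"
  have r: "r > 0"
    using assms(1) by (simp add: r_def)
  \<comment> \<open>With this scaling each of the two nonzero columns has squared norm r, so the
    squared Frobenius norm is 2r > r.\<close>
  define W :: "real^'T^'n" where
    "W = (\<chi> i j. if i = a \<and> j = c \<or> i = b \<and> j = d then sqrt r else 0)"
  have col: "column j W =
      (if j = c then axis a (sqrt r) else if j = d then axis b (sqrt r) else 0)" for j
    using ab cd by (auto simp: W_def column_def axis_def vec_eq_iff)
  \<comment> \<open>As c \<noteq> d, the nested conditional is a sum of two independent ones, each
    with a single nonzero term.\<close>
  have sum2: "(\<Sum>j\<in>UNIV. if j = c then x else if j = d then y else 0) = x + y" for x y :: real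
  proof -
    have "(\<Sum>j\<in>UNIV. if j = c then x else if j = d then y else 0) =
        (\<Sum>j\<in>UNIV. (if j = c then x else 0) + (if j = d then y else 0))"
      using cd by (intro sum.cong) auto
    then show ?thesis
      by (simp add: sum.distrib)
  qed
  have "(norm W)\<^sup>2 = (\<Sum>j\<in>UNIV. if j = c then r else if j = d then r else 0)"
    unfolding norm_square_eq_sum_columns using r
    by (intro sum.cong) (auto simp: col power2_norm_eq_inner inner_axis_axis)
  then have "W \<notin> W_F (Phi_eps \<epsilon>)"
    using r by (simp add: sum2 W_F_Phi_eps_iff r_def)
  moreover have "(norm (x v* W))\<^sup>2 \<le> r * (norm x)\<^sup>2" for x
  proof -
    have "(norm (x v* W))\<^sup>2 =
        (\<Sum>j\<in>UNIV. if j = c then r * (x $ a)\<^sup>2 else if j = d then r * (x $ b)\<^sup>2 else 0)"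
      unfolding norm_square_vector_mult_matrix using r
      by (intro sum.cong) (auto simp: col inner_axis' power_mult_distrib)
    \<comment> \<open>The choice of different rows enters here: as a \<noteq> b, the two squares are
      separate terms of the squared norm of x, so together they do not exceed it.\<close>
    also have "\<dots> = r * (\<Sum>i\<in>{a, b}. (x $ i)\<^sup>2)"
      using ab by (simp add: sum2 algebra_simps)
    also have "\<dots> \<le> r * (\<Sum>i\<in>UNIV. (x $ i)\<^sup>2)"
      using r by (intro mult_left_mono sum_mono2) auto
    also have "(\<Sum>i\<in>UNIV. (x $ i)\<^sup>2) = (norm x)\<^sup>2"
      by (simp add: norm_square_vec)
    finally show ?thesis .
  qed
  ultimately show ?thesis
    by (auto simp: W_qmi_Psi_eps_iff r_def)
qed

theorem lemma1:
  fixes \<epsilon> :: real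
  assumes "0 \<le> \<epsilon>"
  shows "(W_ib \<epsilon> :: (real^'T::finite^'n::finite) set) \<subseteq> W_F (Phi_eps \<epsilon>) \<and>
         (W_F (Phi_eps \<epsilon>) :: (real^'T^'n) set) \<subseteq> W_qmi (Psi_eps \<epsilon>) \<and>
         ((W_F (Phi_eps \<epsilon>) :: (real^'T^'n) set) = W_qmi (Psi_eps \<epsilon>) \<longleftrightarrow>
            \<epsilon> = 0 \<or> CARD('n) = 1 \<or> CARD('T) = 1)"
proof (intro conjI iffI)
  assume "(W_F (Phi_eps \<epsilon>) :: (real^'T^'n) set) = W_qmi (Psi_eps \<epsilon>)"
  then show "\<epsilon> = 0 \<or> CARD('n) = 1 \<or> CARD('T) = 1"
    using ex_W_qmi_not_W_F[of \<epsilon>, where 'n = 'n and 'T = 'T] assms by force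
next
  assume cases: "\<epsilon> = 0 \<or> CARD('n) = 1 \<or> CARD('T) = 1"
  \<comment> \<open>The row bound covers \<epsilon> = 0 and n = 1, the single-column bound covers T
    = 1.\<close>
  have "W \<in> W_F (Phi_eps \<epsilon>)" if W: "W \<in> W_qmi (Psi_eps \<epsilon>)" for W :: "real^'T^'n"
    using cases norm_square_le_of_W_qmi[OF W] norm_square_le_of_W_qmi_single_column[OF W _ assms]
    by (auto simp: W_F_Phi_eps_iff)
  then show "(W_F (Phi_eps \<epsilon>) :: (real^'T^'n) set) = W_qmi (Psi_eps \<epsilon>)"
    using W_F_subset_W_qmi by blast
qed (rule W_ib_subset_W_F W_F_subset_W_qmi)+

end
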